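(* Let $n\ge 1$ be an integer and let $\alpha_i,\beta_i,\gamma_i$ ($i=1,\dots,n$) be real numbers with $\min(\alpha_i,\gamma_i)\ge 1$ and $\beta_i>0$ for all $i=1,\dots,n$, and with $\alpha_j+\beta_j\ge 4$ for some $j\in\{1,\dots,n\}$. Let $$\mathbf{F}(z)=z\prod_{i=1}^{n}[\Gamma(\beta_i)]^{\gamma_i}\sum_{m=0}^{\infty}\frac{z^{m}}{\prod_{i=1}^{n}[\Gamma(\alpha_i m+\beta_i)]^{\gamma_i}}$$ be the standard normalized multi-index Le Roy type function. Then the following statements are true. (1) $\mathbf{F}$ is exponentially starlike in $\mathcal{D}=\{z\in\mathbb{C}:|z|<1\}$ if $$(2e-1)\prod_{i=1}^{n}[\Gamma(\beta_i)]^{\gamma_i}<\prod_{i=1}^{n}[\Gamma(\alpha_i+\beta_i)]^{\gamma_i}.$$ (2) $\mathbf{F}$ is exponentially convex in $\mathcal{D}$ if $$(4e^{2}-4e+2)\prod_{i=1}^{n}[\Gamma(\beta_i)]^{\gamma_i}<(e-1)\prod_{i=1}^{n}[\Gamma(\alpha_i+\beta_i)]^{\gamma_i}.$$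
   Context: $\Gamma$ is the Euler gamma function. $\mathcal{A}$ is the class of analytic functions $f$ on $\mathcal{D}$ with $f(0)=f'(0)-1=0$. Subordination: an analytic function $p$ on $\mathcal{D}$ is subordinate to an analytic univalent function $g$ on $\mathcal{D}$ if there exists an analytic function $w$ on $\mathcal{D}$ with $w(0)=0$ and $|w(z)|\le|z|<1$ such that $p(z)=g(w(z))$ for all $z\in\mathcal{D}$ (equivalently, $p(0)=g(0)$ and $p(\mathcal{D})\subset g(\mathcal{D})$). $P_e$ is the class of analytic functions $p$ on $\mathcal{D}$ with $p(0)=1$ that are subordinate to $e^{z}$ on $\mathcal{D}$. A function $f\in\mathcal{A}$ is exponentially starlike in $\mathcal{D}$ if $\frac{zf'(z)}{f(z)}$ belongs to $P_e$, and exponentially convex in $\mathcal{D}$ if $1+\frac{zf''(z)}{f'(z)}$ belongs to $P_e$ (the quotient $zf'(z)/f(z)$ is understood to take the value $1$ at $z=0$). *)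

theory Defs
  imports "HOL-Complex_Analysis.Complex_Analysis"
begin

abbreviation unit_disc :: "complex set" where
  "unit_disc \<equiv> ball 0 1"

definition class_A :: "(complex \<Rightarrow> complex) set" where
  "class_A = {f. f holomorphic_on unit_disc \<and> f 0 = 0 \<and> deriv f 0 - 1 = 0}"

definition subordinate :: "(complex \<Rightarrow> complex) \<Rightarrow> (complex \<Rightarrow> complex) \<Rightarrow> bool" where
  "subordinate p g \<longleftrightarrow>
     p holomorphic_on unit_disc \<and>
     g holomorphic_on unit_disc \<and> inj_on g unit_disc \<and>
     (\<exists>w. w holomorphic_on unit_disc \<and> w 0 = 0 \<and>
          (\<forall>z\<in>unit_disc. norm (w z) \<le> norm z) \<and>
          (\<forall>z\<in>unit_disc. p z = g (w z)))"

definition class_Pe :: "(complex \<Rightarrow> complex) set" where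
  "class_Pe = {p. p holomorphic_on unit_disc \<and> p 0 = 1 \<and> subordinate p exp}"

text \<open>The nonvanishing conditions in the next two definitions only say that the quotients are
  genuine, so that the convention \<open>x / 0 = 0\<close> plays no role: at a further zero of \<open>f\<close>
  (respectively a zero of \<open>f'\<close>) the quotient would have a pole and could not be analytic.\<close>

definition exponentially_starlike :: "(complex \<Rightarrow> complex) \<Rightarrow> bool" where
  "exponentially_starlike f \<longleftrightarrow>
     f \<in> class_A \<and>
     (\<forall>z\<in>unit_disc - {0}. f z \<noteq> 0) \<and>
     (\<lambda>z. if z = 0 then 1 else z * deriv f z / f z) \<in> class_Pe"

definition exponentially_convex :: "(complex \<Rightarrow> complex) \<Rightarrow> bool" where
  "exponentially_convex f \<longleftrightarrow>
     f \<in> class_A \<and>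
     (\<forall>z\<in>unit_disc. deriv f z \<noteq> 0) \<and>
     (\<lambda>z. 1 + z * deriv (deriv f) z / deriv f z) \<in> class_Pe"

text \<open>The parameters are indexed by \<open>1, \<dots>, n\<close>. For \<open>\<alpha> i, \<beta> i > 0\<close> all Gamma values are
  positive reals, so \<open>powr\<close> is the usual real power.\<close>

definition le_roy_F ::
  "nat \<Rightarrow> (nat \<Rightarrow> real) \<Rightarrow> (nat \<Rightarrow> real) \<Rightarrow> (nat \<Rightarrow> real) \<Rightarrow> complex \<Rightarrow> complex" where
  "le_roy_F n \<alpha> \<beta> \<gamma> z =
     z * complex_of_real (\<Prod>i=1..n. Gamma (\<beta> i) powr \<gamma> i) *
     (\<Sum>m. z ^ m / complex_of_real (\<Prod>i=1..n. Gamma (\<alpha> i * real m + \<beta> i) powr \<gamma> i))"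

end

theory Submission
  imports Defs
begin

text \<open>
  The image of the unit disc under \<open>exp\<close> contains the disc of radius \<open>1 - 1/e\<close> about \<open>1\<close>: if
  \<open>\<bar>u\<bar> < 1 - 1/e\<close>, the logarithm series gives \<open>\<bar>Ln (1 + u)\<bar> \<le> - ln (1 - \<bar>u\<bar>) < 1\<close>. Composing with
  \<open>Ln\<close> and applying the Schwarz lemma, every analytic \<open>p\<close> with \<open>p 0 = 1\<close> whose values stay in
  that smaller disc is subordinate to \<open>exp\<close> (lemma \<open>class_PeI\<close>). So it suffices to keep
  \<open>\<bar>z f' / f - 1\<bar>\<close> below \<open>1 - 1/e\<close>.

  For \<open>f = z + \<Sum>k\<ge>2. c k z^k\<close> the triangle inequality reduces this to the linear condition
  \<open>(\<Sum>k\<ge>2. (e k - 1) \<bar>c k\<bar>) < e - 1\<close> (lemma \<open>exponentially_starlike_coeff_criterion\<close>). By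
  Alexander's relation, \<open>f\<close> is exponentially convex as soon as \<open>z f'\<close> is exponentially starlike,
  so for convexity the weight \<open>e k - 1\<close> is replaced by \<open>k (e k - 1)\<close>.

  For the Le Roy type function put \<open>P m = (\<Prod>i. Gamma (\<alpha> i m + \<beta> i) powr \<gamma> i)\<close>, so that
  \<open>c (m + 1) = P 0 / P m\<close>. Passing from \<open>P 1\<close> to \<open>P (k + 1)\<close>, no factor decreases, and the
  factor with \<open>\<alpha> j + \<beta> j \<ge> 4\<close> grows at least by the rising factorial
  \<open>4 \<cdot> 5 \<cdots> (k + 3) = (k + 3)! / 6\<close> (lemma \<open>Gamma_product_growth\<close>). With \<open>\<rho> = P 0 / P 1\<close> this
  yields \<open>c (k + 2) \<le> 6 \<rho> / (k + 3)!\<close>, and the two weighted sums of this majorant are exact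
  expressions in \<open>e\<close>: \<open>\<rho> (15 - 3 e)\<close> and \<open>\<rho> (6 e^2 - 9 e - 3)\<close>. The hypotheses
  \<open>(2 e - 1) \<rho> < 1\<close> and \<open>(4 e^2 - 4 e + 2) \<rho> < e - 1\<close> push them below \<open>e - 1\<close> because
  \<open>15 - 3 e \<le> (e - 1) (2 e - 1)\<close>, that is \<open>e^2 \<ge> 7\<close>, and because \<open>2 e^2 - 5 e - 5 \<le> 0\<close>.
\<close>

section \<open>Functions close to 1 are subordinate to the exponential\<close>

text \<open>Termwise, the absolute values of the series of \<open>Ln (1 + u)\<close> form the series of
  \<open>- ln (1 - \<bar>u\<bar>)\<close>.\<close>

lemma norm_Ln_one_plus_le:
  fixes u :: complex
  assumes "norm u < 1"
  shows "norm (Ln (1 + u)) \<le> - ln (1 - norm u)"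
proof -
  have c: "(\<lambda>n. - ((-u)^n) / of_nat n) sums Ln (1 + u)"
    by (rule Ln_series'[OF assms])
  have "(\<lambda>n. - ((norm u)^n) / real n) sums ln (1 - norm u)"
    using ln_series'[of "- norm u"] assms by simp
  then have r: "(\<lambda>n. norm (- ((-u)^n) / of_nat n)) sums (- ln (1 - norm u))"
    using sums_minus by (fastforce simp: norm_divide norm_power)
  show ?thesis
    using summable_norm[OF sums_summable[OF r]] sums_unique[OF r] sums_unique[OF c] by simp
qed

text \<open>Values outside the disc do not matter for membership in the class. This is needed for
  formulas involving derivatives, which are controlled only inside the disc.\<close>

lemma class_Pe_cong:
  assumes "p \<in> class_Pe" "\<And>z. z \<in> unit_disc \<Longrightarrow> q z = p z"
  shows "q \<in> class_Pe"
proof -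
  have "q holomorphic_on unit_disc \<longleftrightarrow> p holomorphic_on unit_disc"
    by (rule holomorphic_cong) (use assms(2) in auto)
  moreover have "q 0 = p 0" using assms(2) by simp
  ultimately show ?thesis
    using assms by (auto simp: class_Pe_def subordinate_def)
qed

text \<open>The Schwarz function is \<open>Ln \<circ> p\<close>: the values of \<open>p\<close> lie in the right half plane, where
  \<open>Ln\<close> is analytic, and \<open>- ln (1 - t) < 1\<close> exactly when \<open>t < 1 - 1/e\<close>.\<close>

lemma class_PeI:
  assumes hol: "p holomorphic_on unit_disc" and "p 0 = 1"
    and close: "\<And>z. z \<in> unit_disc \<Longrightarrow> norm (p z - 1) < 1 - exp (-1)"
  shows "p \<in> class_Pe"
proof -
  define w where "w z = Ln (p z)" for z
  have re: "Re (p z) > 0" if "z \<in> unit_disc" for z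
  proof -
    have "\<bar>Re (p z - 1)\<bar> < 1"
      using close[OF that] abs_Re_le_cmod[of "p z - 1"] exp_gt_zero[of "-1::real"] by linarith
    then show ?thesis by simp
  qed
  have holw: "w holomorphic_on unit_disc"
    unfolding w_def using re
    by (intro holomorphic_on_Ln' hol) (fastforce simp: complex_nonpos_Reals_iff dest: re)
  have w0: "w 0 = 0" using assms by (simp add: w_def)
  have lt1: "norm (w z) < 1" if "norm z < 1" for z
  proof -
    have z: "norm (p z - 1) < 1 - exp (-1)" using close that by simp
    also have "\<dots> < 1" by simp
    finally have lt: "norm (p z - 1) < 1" .
    then have "norm (w z) \<le> - ln (1 - norm (p z - 1))"
      using norm_Ln_one_plus_le[of "p z - 1"] by (simp add: w_def)
    moreover have "ln (exp (-1)) < ln (1 - norm (p z - 1))"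
      using z lt by (subst ln_less_cancel_iff) auto
    ultimately show ?thesis by simp
  qed
  have "norm (w z) \<le> norm z" if "norm z < 1" for z
    using Schwarz_Lemma(1)[OF holw w0 lt1 that] by simp
  moreover have "p z = exp (w z)" if "z \<in> unit_disc" for z
    using re[OF that] by (cases "p z = 0") (simp_all add: w_def)
  moreover have "inj_on exp unit_disc"
    by (rule inj_on_subset[OF inj_on_exp_pi[of 0]]) (use pi_gt3 in auto)
  ultimately show ?thesis
    using assms holw w0 by (auto simp: class_Pe_def subordinate_def intro!: holomorphic_intros)
qed

section \<open>Coefficient criteria\<close>

text \<open>The operator \<open>z d/dz\<close> multiplies the \<open>k\<close>-th coefficient by \<open>k\<close>; unlike plain
  differentiation it does not shift the index.\<close>

lemma power_series_deriv:
  fixes c :: "nat \<Rightarrow> complex"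
  assumes ser: "\<And>z. z \<in> unit_disc \<Longrightarrow> (\<lambda>k. c k * z ^ k) sums f z" and z: "z \<in> unit_disc"
  shows "(\<lambda>k. of_nat k * c k * z ^ k) sums (z * deriv f z)"
    and "deriv f 0 = c 1"
proof -
  have *: "summable (\<lambda>k. c k * z ^ k)" if "norm z < 1" for z
    using ser[of z] that by (simp add: sums_iff)
  have der: "deriv f z = (\<Sum>k. diffs c k * z ^ k)" if "norm z < 1" for z
  proof -
    have "((\<lambda>z. \<Sum>k. c k * z ^ k) has_field_derivative (\<Sum>k. diffs c k * z ^ k)) (at z)"
      by (rule termdiffs_strong'[OF * that])
    then have "(f has_field_derivative (\<Sum>k. diffs c k * z ^ k)) (at z)"
      by (rule has_field_derivative_transform_within_open[where S=unit_disc])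
         (use that ser in \<open>auto simp: sums_iff\<close>)
    then show ?thesis by (rule DERIV_imp_deriv)
  qed
  show "deriv f 0 = c 1" by (simp add: der powser_zero diffs_def)
  have "summable (\<lambda>k. diffs c k * z ^ k)"
    by (rule termdiff_converges[OF _ *]) (use z in auto)
  from sums_mult[OF diffs_equiv[OF this], of z]
  have "(\<lambda>k. z * (of_nat k * c k * z ^ (k - Suc 0))) sums (z * deriv f z)"
    using z by (simp add: der)
  moreover have "z * (of_nat k * c k * z ^ (k - Suc 0)) = of_nat k * c k * z ^ k" for k
    by (cases k) auto
  ultimately show "(\<lambda>k. of_nat k * c k * z ^ k) sums (z * deriv f z)" by simp
qed

text \<open>Only one of the powers of \<open>\<bar>z\<bar>\<close> is kept in the bound. It is the one that cancels
  against the zero of \<open>f\<close> at the origin when the quotient \<open>z f' / f\<close> is estimated.\<close>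

lemma power_series_tail_le:
  fixes d :: "nat \<Rightarrow> complex"
  assumes y: "(\<lambda>k. d k * z ^ k) sums y" and "d 0 = 0" and z: "norm z < 1"
    and sum: "summable (\<lambda>k. norm (d (k + 2)))"
  shows "norm (y - d 1 * z) \<le> norm z * (\<Sum>k. norm (d (k + 2)))"
proof -
  have "(\<lambda>k. d (k + 2) * z ^ (k + 2)) sums (y - d 1 * z)"
    using sums_split_initial_segment[OF y, of 2] \<open>d 0 = 0\<close> by (simp add: numeral_2_eq_2)
  moreover have le: "norm (d (k + 2) * z ^ (k + 2)) \<le> norm z * norm (d (k + 2))" for k
  proof -
    have "norm z ^ (k + 2) \<le> norm z ^ 1"
      using z by (intro power_decreasing) auto
    then show ?thesis
      using mult_left_mono[of "norm z ^ (k + 2)" "norm z" "norm (d (k + 2))"]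
      by (simp add: norm_mult norm_power mult.commute del: power_Suc)
  qed
  moreover have s: "summable (\<lambda>k. norm z * norm (d (k + 2)))"
    by (intro summable_mult sum)
  ultimately have "norm (y - d 1 * z) \<le> (\<Sum>k. norm z * norm (d (k + 2)))"
    using norm_suminf_le[OF le s] by (simp add: sums_iff)
  then show ?thesis using suminf_mult[OF sum] by simp
qed

text \<open>With \<open>S = (\<Sum>k\<ge>2. \<bar>c k\<bar>)\<close> and \<open>N = (\<Sum>k\<ge>2. (k - 1) \<bar>c k\<bar>)\<close> one has \<open>\<bar>f\<bar> \<ge> \<bar>z\<bar> (1 - S)\<close> and
  \<open>\<bar>z f' - f\<bar> \<le> \<bar>z\<bar> N\<close>. Since \<open>e k - 1 = e (k - 1) + (e - 1)\<close>, the hypothesis reads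
  \<open>e N + (e - 1) S < e - 1\<close>, which is \<open>N < (1 - 1/e) (1 - S)\<close>. The index is shifted by two
  so that the sums start at zero.\<close>

lemma exponentially_starlike_coeff_criterion:
  fixes c :: "nat \<Rightarrow> complex"
  assumes ser: "\<And>z. z \<in> unit_disc \<Longrightarrow> (\<lambda>k. c k * z ^ k) sums f z"
    and c0: "c 0 = 0" and c1: "c 1 = 1"
    and summ: "summable (\<lambda>k. (exp 1 * real (k + 2) - 1) * norm (c (k + 2)))"
    and less: "(\<Sum>k. (exp 1 * real (k + 2) - 1) * norm (c (k + 2))) < exp 1 - 1"
  shows "exponentially_starlike f"
proof -
  define e :: real where "e = exp 1"
  have e2: "e \<ge> 2" unfolding e_def using exp_ge_add_one_self[of "1::real"] by simp
  define a where "a k = norm (c (k + 2))" for k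
  have a0: "a k \<ge> 0" for k by (simp add: a_def)
  have W: "(e * real (k + 2) - 1) * a k = e * ((real k + 1) * a k) + (e - 1) * a k" for k
    by (simp add: algebra_simps)
  have summW: "summable (\<lambda>k. e * ((real k + 1) * a k) + (e - 1) * a k)"
    using summ W unfolding e_def a_def by simp
  have sN: "summable (\<lambda>k. (real k + 1) * a k)"
  proof (rule summable_comparison_test'[OF summW])
    fix k
    have "1 * ((real k + 1) * a k) \<le> e * ((real k + 1) * a k)"
      using e2 a0[of k] by (intro mult_right_mono) auto
    moreover have "0 \<le> (e - 1) * a k" using e2 a0[of k] by auto
    ultimately show "norm ((real k + 1) * a k) \<le> e * ((real k + 1) * a k) + (e - 1) * a k"
      using a0[of k] by (simp only: real_norm_def abs_of_nonneg mult_nonneg_nonneg)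
  qed
  have sS: "summable a"
    by (rule summable_comparison_test'[OF sN, of 0]) (use a0 in \<open>auto simp: algebra_simps\<close>)
  define N where "N = (\<Sum>k. (real k + 1) * a k)"
  define S where "S = (\<Sum>k. a k)"
  have "(\<Sum>k. (e * real (k + 2) - 1) * a k) = e * N + (e - 1) * S"
    unfolding W N_def S_def using sN sS
    by (simp add: suminf_add[symmetric] suminf_mult summable_mult)
  then have NS: "e * N + (e - 1) * S < e - 1"
    using less unfolding e_def a_def by simp
  have N0: "N \<ge> 0" unfolding N_def using a0 by (intro suminf_nonneg sN) auto
  have S1: "S < 1"
  proof -
    have "e * N \<ge> 0" using e2 N0 by simp
    then have "(e - 1) * S < (e - 1) * 1" using NS by simp
    then show ?thesis using e2 by (subst (asm) mult_less_cancel_left_pos) auto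
  qed
  have NS': "N < (1 - exp (-1)) * (1 - S)"
  proof -
    have "e * N < e * ((1 - exp (-1)) * (1 - S))"
      using NS e2 by (simp add: e_def algebra_simps flip: exp_add)
    then show ?thesis using e2 by (subst (asm) mult_less_cancel_left_pos) auto
  qed

  have holf: "f holomorphic_on unit_disc"
    by (rule power_series_holomorphic[where a=c]) (use ser in auto)
  have f0: "f 0 = 0"
    using ser[of 0] c0 by (simp add: sums_iff powser_zero)
  have df0: "deriv f 0 = 1"
    using power_series_deriv(2)[OF ser, of 0] c1 by simp

  have est: "f z \<noteq> 0 \<and> norm (z * deriv f z - f z) < (1 - exp (-1)) * norm (f z)"
    if z: "z \<in> unit_disc" "z \<noteq> 0" for z
  proof -
    have z1: "norm z < 1" using z by simp
    have "norm (f z - z) \<le> norm z * S"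
      using power_series_tail_le[OF ser[OF z(1)] c0 z1] sS c1 by (simp add: S_def a_def[abs_def])
    moreover have "norm z \<le> norm (f z) + norm (f z - z)"
      by (metis norm_minus_commute norm_triangle_sub)
    ultimately have fz: "norm z * (1 - S) \<le> norm (f z)"
      by (simp add: algebra_simps)
    let ?d = "\<lambda>k. (of_nat k - 1) * c k"
    have d: "(\<lambda>k. ?d k * z ^ k) sums (z * deriv f z - f z)"
      using sums_diff[OF power_series_deriv(1)[OF ser z(1)] ser[OF z(1)]]
      by (simp add: algebra_simps)
    have nd: "norm (?d (k + 2)) = (real k + 1) * a k" for k
    proof -
      have "of_nat (k + 2) - (1 :: complex) = of_nat (k + 1)" by simp
      then show ?thesis unfolding norm_mult a_def by (simp only: norm_of_nat) simp
    qed
    have "norm (z * deriv f z - f z) \<le> norm z * N"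
      using power_series_tail_le[OF d _ z1] c0 sN unfolding nd N_def by simp
    also have "\<dots> < norm z * ((1 - exp (-1)) * (1 - S))"
      using NS' z by (intro mult_strict_left_mono) auto
    also have "\<dots> = (1 - exp (-1)) * (norm z * (1 - S))" by simp
    also have "\<dots> \<le> (1 - exp (-1)) * norm (f z)"
      by (intro mult_left_mono fz) auto
    finally have "norm (z * deriv f z - f z) < (1 - exp (-1)) * norm (f z)" .
    moreover have "0 < norm z * (1 - S)" using z S1 by simp
    ultimately show ?thesis using fz by force
  qed

  \<comment> \<open>Dividing out the zero at the origin exhibits the quotient as a ratio of analytic functions,
    including at \<open>0\<close>, where it is defined separately.\<close>
  obtain h where h: "h holomorphic_on unit_disc" "\<And>z. norm z < 1 \<Longrightarrow> f z = z * h z"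
    "deriv f 0 = h 0"
    using Schwarz3[OF holf f0] by metis
  have hnz: "h z \<noteq> 0" if "z \<in> unit_disc" for z
    using est[of z] h(2)[of z] h(3) df0 that by (cases "z = 0") auto
  let ?p = "\<lambda>z. if z = 0 then 1 else z * deriv f z / f z"
  have p: "?p z = deriv f z / h z" if "z \<in> unit_disc" for z
    using h(2)[of z] h(3) df0 that by auto
  have "(\<lambda>z. deriv f z / h z) holomorphic_on unit_disc"
    using holf h(1) hnz by (intro holomorphic_intros) auto
  then have "?p holomorphic_on unit_disc"
    by (subst holomorphic_cong[OF refl p]) auto
  moreover have "norm (?p z - 1) < 1 - exp (-1)" if "z \<in> unit_disc" for z
  proof (cases "z = 0")
    case False
    then have f: "f z \<noteq> 0" "norm (z * deriv f z - f z) < (1 - exp (-1)) * norm (f z)"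
      using est that by auto
    have "?p z - 1 = (z * deriv f z - f z) / f z"
      using False f by (simp add: field_simps)
    then show ?thesis using f by (simp add: norm_divide divide_less_eq)
  qed auto
  ultimately have "?p \<in> class_Pe" by (intro class_PeI) auto
  then show ?thesis
    using est holf f0 df0 by (auto simp: exponentially_starlike_def class_A_def)
qed

text \<open>Alexander's relation: for \<open>g = z f'\<close> one has \<open>z g' / g = 1 + z f'' / f'\<close>. At the origin both
  sides are \<open>1\<close>.\<close>

lemma exponentially_convex_if_starlike_deriv:
  assumes f: "f \<in> class_A" and g: "exponentially_starlike (\<lambda>z. z * deriv f z)"
  shows "exponentially_convex f"
proof -
  let ?g = "\<lambda>z. z * deriv f z"
  have holf: "f holomorphic_on unit_disc" and df0: "deriv f 0 = 1"
    using f by (auto simp: class_A_def)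
  have nz: "deriv f z \<noteq> 0" if "z \<in> unit_disc" for z
    using g df0 that by (cases "z = 0") (auto simp: exponentially_starlike_def)
  have holf': "deriv f holomorphic_on unit_disc"
    using holf by (intro holomorphic_deriv) auto
  have dg: "deriv ?g z = deriv f z + z * deriv (deriv f) z" if "z \<in> unit_disc" for z
  proof -
    have "(deriv f has_field_derivative deriv (deriv f) z) (at z)"
      using holomorphic_derivI[OF holf' _ that] by simp
    then show ?thesis
      by (intro DERIV_imp_deriv) (auto intro!: derivative_eq_intros)
  qed
  have "(\<lambda>z. 1 + z * deriv (deriv f) z / deriv f z) \<in> class_Pe"
    by (rule class_Pe_cong[of "\<lambda>z. if z = 0 then 1 else z * deriv ?g z / ?g z"])
       (use g nz dg in \<open>auto simp: exponentially_starlike_def field_simps\<close>)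
  then show ?thesis using f nz by (auto simp: exponentially_convex_def)
qed

lemma exponentially_convex_coeff_criterion:
  fixes c :: "nat \<Rightarrow> complex"
  assumes ser: "\<And>z. z \<in> unit_disc \<Longrightarrow> (\<lambda>k. c k * z ^ k) sums f z"
    and c0: "c 0 = 0" and c1: "c 1 = 1"
    and summ: "summable (\<lambda>k. real (k + 2) * (exp 1 * real (k + 2) - 1) * norm (c (k + 2)))"
    and less: "(\<Sum>k. real (k + 2) * (exp 1 * real (k + 2) - 1) * norm (c (k + 2))) < exp 1 - 1"
  shows "exponentially_convex f"
proof (rule exponentially_convex_if_starlike_deriv)
  have "f holomorphic_on unit_disc"
    by (rule power_series_holomorphic[where a=c]) (use ser in auto)
  moreover have "f 0 = 0"
    using ser[of 0] c0 by (simp add: sums_iff powser_zero)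
  moreover have "deriv f 0 = 1"
    using power_series_deriv(2)[OF ser, of 0] c1 by simp
  ultimately show "f \<in> class_A" by (simp add: class_A_def)
  have eq: "(exp 1 * real (k + 2) - 1) * norm (of_nat (k + 2) * c (k + 2)) =
      real (k + 2) * (exp 1 * real (k + 2) - 1) * norm (c (k + 2))" for k
    unfolding norm_mult norm_of_nat by simp
  show "exponentially_starlike (\<lambda>z. z * deriv f z)"
    by (rule exponentially_starlike_coeff_criterion[where c="\<lambda>k. of_nat k * c k"])
       (use c1 summ less power_series_deriv(1)[OF ser] in \<open>simp_all only: eq\<close>, simp_all)
qed

section \<open>Growth of the Gamma products\<close>

lemma pochhammer_mono:
  fixes x y :: real
  assumes "0 \<le> y" "y \<le> x"
  shows "pochhammer y r \<le> pochhammer x r"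
  unfolding pochhammer_prod using assms by (intro prod_mono) auto

text \<open>Since \<open>Gamma\<close> decreases on part of \<open>(1, 2)\<close>, monotonicity cannot be applied at \<open>x\<close> itself.
  The functional equation first carries the argument to \<open>x + r\<close>; for \<open>r \<ge> 1\<close> this exceeds \<open>2\<close>,
  and \<open>Gamma\<close> increases from there to \<open>x + \<alpha> r\<close>.\<close>

lemma Gamma_growth:
  fixes x y \<alpha> :: real
  assumes x: "x > 1" and \<alpha>: "\<alpha> \<ge> 1" and y: "0 \<le> y" "y \<le> x"
  shows "pochhammer y r * Gamma x \<le> Gamma (x + \<alpha> * real r)"
proof (cases "r = 0")
  case False
  have "pochhammer y r * Gamma x \<le> pochhammer x r * Gamma x"
    using x y by (intro mult_right_mono pochhammer_mono) (auto intro: less_imp_le)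
  also have "\<dots> = Gamma (x + real r)"
    using x Gamma_real_pos[of x] by (subst pochhammer_Gamma) (auto elim!: nonpos_Ints_cases simp: less_imp_neq[symmetric])
  also have "\<dots> \<le> Gamma (x + \<alpha> * real r)"
  proof (cases "\<alpha> = 1")
    case neq: False
    have "1 * real r < \<alpha> * real r"
      using \<alpha> neq False by (intro mult_strict_right_mono) auto
    then show ?thesis
      using neq x False by (intro less_imp_le Gamma_real_strict_mono) auto
  qed auto
  finally show ?thesis .
qed simp

text \<open>The factor gained by an exponent \<open>\<gamma> \<ge> 1\<close> is at least as large as without it, because
  the rising factorial is at least \<open>1\<close> when \<open>y \<ge> 1\<close>.\<close>

lemma Gamma_powr_growth:
  fixes x y \<alpha> \<gamma> :: real
  assumes "x > 1" "\<alpha> \<ge> 1" "\<gamma> \<ge> 1" "1 \<le> y" "y \<le> x"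
  shows "pochhammer y r * Gamma x powr \<gamma> \<le> Gamma (x + \<alpha> * real r) powr \<gamma>"
proof -
  have G: "Gamma x > 0" using assms by simp
  have p1: "pochhammer y r \<ge> 1"
    unfolding pochhammer_prod using assms by (intro prod_ge_1) auto
  have "pochhammer y r \<le> pochhammer y r powr \<gamma>"
    using powr_mono[of 1 \<gamma> "pochhammer y r"] p1 assms by simp
  then have "pochhammer y r * Gamma x powr \<gamma> \<le> pochhammer y r powr \<gamma> * Gamma x powr \<gamma>"
    by (intro mult_right_mono) auto
  also have "\<dots> = (pochhammer y r * Gamma x) powr \<gamma>"
    using p1 G by (subst powr_mult) auto
  also have "\<dots> \<le> Gamma (x + \<alpha> * real r) powr \<gamma>"
    using assms p1 G by (intro powr_mono2 Gamma_growth) auto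
  finally show ?thesis .
qed

text \<open>The factor \<open>j\<close> contributes the rising factorial of \<open>4\<close>. For the other indices
  \<open>\<alpha> i + \<beta> i > 1\<close>, and the rising factorial of \<open>1\<close>, which is \<open>r!\<close>, shows that they do not
  decrease.\<close>

lemma Gamma_product_growth:
  fixes \<alpha> \<beta> \<gamma> :: "'i \<Rightarrow> real"
  assumes I: "finite I" and j: "j \<in> I" "\<alpha> j + \<beta> j \<ge> 4"
    and par: "\<And>i. i \<in> I \<Longrightarrow> \<alpha> i \<ge> 1 \<and> \<gamma> i \<ge> 1 \<and> \<beta> i > 0"
  shows "fact (r + 3) / 6 * (\<Prod>i\<in>I. Gamma (\<alpha> i + \<beta> i) powr \<gamma> i)
    \<le> (\<Prod>i\<in>I. Gamma (\<alpha> i * real (r + 1) + \<beta> i) powr \<gamma> i)"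
proof -
  have p4: "pochhammer (4::real) r = fact (r + 3) / 6"
  proof -
    have "(fact (r + 3) :: real) = fact (3 + r)" by (simp add: add.commute)
    also have "\<dots> = pochhammer 1 (3 + r)" by (simp only: pochhammer_fact)
    also have "\<dots> = 6 * pochhammer 4 r"
      by (simp add: pochhammer_product' numeral_3_eq_3 pochhammer_rec)
    finally show ?thesis by simp
  qed
  have eq: "\<alpha> i * real (r + 1) + \<beta> i = (\<alpha> i + \<beta> i) + \<alpha> i * real r" for i
    by (simp add: algebra_simps)
  have step: "pochhammer y r * Gamma (\<alpha> i + \<beta> i) powr \<gamma> i
      \<le> Gamma (\<alpha> i * real (r + 1) + \<beta> i) powr \<gamma> i"
    if "i \<in> I" "1 \<le> y" "y \<le> \<alpha> i + \<beta> i" for i y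
    unfolding eq using par[OF that(1)] that by (intro Gamma_powr_growth) auto
  have other: "Gamma (\<alpha> i + \<beta> i) powr \<gamma> i \<le> Gamma (\<alpha> i * real (r + 1) + \<beta> i) powr \<gamma> i"
    if "i \<in> I" for i
  proof -
    have "1 * Gamma (\<alpha> i + \<beta> i) powr \<gamma> i \<le> pochhammer 1 r * Gamma (\<alpha> i + \<beta> i) powr \<gamma> i"
      by (intro mult_right_mono) (auto simp: fact_ge_1 simp flip: pochhammer_fact)
    also have "\<dots> \<le> Gamma (\<alpha> i * real (r + 1) + \<beta> i) powr \<gamma> i"
      using par[OF that] by (intro step that) auto
    finally show ?thesis by simp
  qed
  have "fact (r + 3) / 6 * (\<Prod>i\<in>I. Gamma (\<alpha> i + \<beta> i) powr \<gamma> i) =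
    (pochhammer 4 r * Gamma (\<alpha> j + \<beta> j) powr \<gamma> j) *
      (\<Prod>i\<in>I - {j}. Gamma (\<alpha> i + \<beta> i) powr \<gamma> i)"
    using prod.remove[OF I j(1)] by (simp add: p4 mult.assoc)
  also have "\<dots> \<le> Gamma (\<alpha> j * real (r + 1) + \<beta> j) powr \<gamma> j *
      (\<Prod>i\<in>I - {j}. Gamma (\<alpha> i * real (r + 1) + \<beta> i) powr \<gamma> i)"
    using j by (intro mult_mono step prod_mono conjI other prod_nonneg) auto
  also have "\<dots> = (\<Prod>i\<in>I. Gamma (\<alpha> i * real (r + 1) + \<beta> i) powr \<gamma> i)"
    using prod.remove[OF I j(1), symmetric] by simp
  finally show ?thesis .
qed

section \<open>The two numerical series\<close>

lemma exp_1_tails: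
  shows "(\<lambda>k. 1 / fact (k + 1)) sums (exp 1 - 1 :: real)"
    and "(\<lambda>k. 1 / fact (k + 2)) sums (exp 1 - 2 :: real)"
    and "(\<lambda>k. 1 / fact (k + 3)) sums (exp 1 - 5/2 :: real)"
proof -
  have e: "(\<lambda>k. 1 / fact k) sums (exp 1 :: real)"
    using exp_converges[of "1::real"] by (simp add: divide_inverse)
  show "(\<lambda>k. 1 / fact (k + 1)) sums (exp 1 - 1 :: real)"
    using sums_split_initial_segment[OF e, of 1] by simp
  show "(\<lambda>k. 1 / fact (k + 2)) sums (exp 1 - 2 :: real)"
    using sums_split_initial_segment[OF e, of 2] by (simp add: eval_nat_numeral)
  show "(\<lambda>k. 1 / fact (k + 3)) sums (exp 1 - 5/2 :: real)"
    using sums_split_initial_segment[OF e, of 3] by (simp add: eval_nat_numeral)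
qed

text \<open>The weight is expanded in falling factorials of \<open>K = k + 3\<close>:
  \<open>e (K - 1) - 1 = e K - (e + 1)\<close>, so that each term cancels against \<open>K!\<close>.\<close>

lemma starlike_majorant_sums:
  "(\<lambda>k. (exp 1 * real (k + 2) - 1) * (6 / fact (k + 3))) sums (15 - 3 * exp 1 :: real)"
proof -
  have "(\<lambda>k. 6 * (exp 1 * (1 / fact (k + 2)) - (exp 1 + 1) * (1 / fact (k + 3)))) sums
      (6 * (exp 1 * (exp 1 - 2) - (exp 1 + 1) * (exp 1 - 5/2)) :: real)"
    by (intro sums_mult sums_diff exp_1_tails)
  moreover have "6 * (exp 1 * (1 / fact (k + 2)) - (exp 1 + 1) * (1 / fact (k + 3))) =
      (exp 1 * real (k + 2) - 1) * (6 / fact (k + 3))" for k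
  proof -
    have 1: "(fact (k + 3) :: real) = (real k + 3) * fact (k + 2)"
      by (simp add: eval_nat_numeral algebra_simps)
    show ?thesis unfolding 1 by (simp add: divide_simps del: fact_Suc) (simp add: algebra_simps)
  qed
  moreover have "6 * (exp 1 * (exp 1 - 2) - (exp 1 + 1) * (exp 1 - 5/2)) = (15 - 3 * exp 1 :: real)"
    by (simp add: field_simps)
  ultimately show ?thesis by (simp only:)
qed

text \<open>Likewise \<open>(K - 1) (e (K - 1) - 1) = e K (K - 1) - (e + 1) K + (e + 1)\<close>.\<close>

lemma convex_majorant_sums:
  "(\<lambda>k. real (k + 2) * (exp 1 * real (k + 2) - 1) * (6 / fact (k + 3))) sums
    (6 * exp 1 ^ 2 - 9 * exp 1 - 3 :: real)"
proof -
  have "(\<lambda>k. 6 * (exp 1 * (1 / fact (k + 1)) - (exp 1 + 1) * (1 / fact (k + 2))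
          + (exp 1 + 1) * (1 / fact (k + 3)))) sums
      (6 * (exp 1 * (exp 1 - 1) - (exp 1 + 1) * (exp 1 - 2) + (exp 1 + 1) * (exp 1 - 5/2)) :: real)"
    by (intro sums_mult sums_diff sums_add exp_1_tails)
  moreover have "6 * (exp 1 * (1 / fact (k + 1)) - (exp 1 + 1) * (1 / fact (k + 2))
          + (exp 1 + 1) * (1 / fact (k + 3))) =
      real (k + 2) * (exp 1 * real (k + 2) - 1) * (6 / fact (k + 3))" for k
  proof -
    have 1: "(fact (k + 3) :: real) = (real k + 3) * fact (k + 2)"
      and 2: "(fact (k + 2) :: real) = (real k + 2) * fact (k + 1)"
      by (simp_all add: eval_nat_numeral algebra_simps)
    show ?thesis unfolding 1 2 by (simp add: divide_simps del: fact_Suc) (simp add: algebra_simps)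
  qed
  moreover have "6 * (exp 1 * (exp 1 - 1) - (exp 1 + 1) * (exp 1 - 2) + (exp 1 + 1) * (exp 1 - 5/2)) =
      (6 * exp 1 ^ 2 - 9 * exp 1 - 3 :: real)"
    by (simp add: field_simps power2_eq_square)
  ultimately show ?thesis by (simp only:)
qed

text \<open>The partial sum of the exponential series up to \<open>1/3!\<close>; its square exceeds \<open>7\<close>.\<close>

lemma exp_1_gt_8_3: "exp 1 > (8 / 3 :: real)"
proof -
  have "(\<Sum>k<1. 1 / fact (k + 3)) < (\<Sum>k. 1 / fact (k + 3) :: real)"
    using exp_1_tails(3) by (intro sum_less_suminf) (auto simp: sums_iff)
  then show ?thesis
    using sums_unique[OF exp_1_tails(3)] by (simp add: eval_nat_numeral)
qed

section \<open>Multi-index Le Roy type functions\<close>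

theorem theorem4:
  fixes n :: nat and \<alpha> \<beta> \<gamma> :: "nat \<Rightarrow> real"
  assumes "n \<ge> 1"
    and "\<And>i. i \<in> {1..n} \<Longrightarrow> min (\<alpha> i) (\<gamma> i) \<ge> 1"
    and "\<And>i. i \<in> {1..n} \<Longrightarrow> \<beta> i > 0"
    and "\<exists>j\<in>{1..n}. \<alpha> j + \<beta> j \<ge> 4"
  shows "((2 * exp 1 - 1) * (\<Prod>i=1..n. Gamma (\<beta> i) powr \<gamma> i)
            < (\<Prod>i=1..n. Gamma (\<alpha> i + \<beta> i) powr \<gamma> i)
          \<longrightarrow> exponentially_starlike (le_roy_F n \<alpha> \<beta> \<gamma>)) \<and>
         ((4 * exp 1 ^ 2 - 4 * exp 1 + 2) * (\<Prod>i=1..n. Gamma (\<beta> i) powr \<gamma> i)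
            < (exp 1 - 1) * (\<Prod>i=1..n. Gamma (\<alpha> i + \<beta> i) powr \<gamma> i)
          \<longrightarrow> exponentially_convex (le_roy_F n \<alpha> \<beta> \<gamma>))"
proof -
  define P where "P m = (\<Prod>i=1..n. Gamma (\<alpha> i * real m + \<beta> i) powr \<gamma> i)" for m
  have P0: "P 0 = (\<Prod>i=1..n. Gamma (\<beta> i) powr \<gamma> i)"
    and P1: "P 1 = (\<Prod>i=1..n. Gamma (\<alpha> i + \<beta> i) powr \<gamma> i)"
    by (simp_all add: P_def)
  have par: "\<alpha> i \<ge> 1 \<and> \<gamma> i \<ge> 1 \<and> \<beta> i > 0" if "i \<in> {1..n}" for i
    using assms(2,3)[OF that] by simp
  have Ppos: "P m > 0" for m
  proof -
    have "Gamma (\<alpha> i * real m + \<beta> i) > 0" if "i \<in> {1..n}" for i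
      using par[OF that] by (intro Gamma_real_pos add_nonneg_pos) auto
    then show ?thesis unfolding P_def by (intro prod_pos) force
  qed
  have growth: "fact (k + 3) / 6 * P 1 \<le> P (k + 1)" for k
    using assms(4) Gamma_product_growth[of "{1..n}" _ \<alpha> \<beta> \<gamma> k] par unfolding P1
    by (auto simp: P_def)
  define \<rho> where "\<rho> = P 0 / P 1"
  have \<rho>: "\<rho> > 0" using Ppos by (simp add: \<rho>_def)
  have ratio: "P 0 / P (k + 1) \<le> \<rho> * (6 / fact (k + 3))" for k
  proof -
    have "P 0 / P (k + 1) \<le> P 0 / (fact (k + 3) / 6 * P 1)"
      using growth[of k] Ppos[of 0] Ppos[of 1]
      by (intro divide_left_mono mult_pos_pos) (auto intro: Ppos)
    then show ?thesis by (simp add: \<rho>_def mult_ac)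
  qed

  define c :: "nat \<Rightarrow> complex"
    where "c k = (case k of 0 \<Rightarrow> 0 | Suc m \<Rightarrow> of_real (P 0 / P m))" for k
  have c0: "c 0 = 0" and c1: "c 1 = 1"
    using Ppos[of 0] by (simp_all add: c_def)
  have nc: "norm (c (k + 2)) = P 0 / P (k + 1)" for k
    using Ppos[of 0] Ppos[of "Suc k"] by (simp add: c_def norm_divide)
  have ser: "(\<lambda>k. c k * z ^ k) sums le_roy_F n \<alpha> \<beta> \<gamma> z" if z: "z \<in> unit_disc" for z
  proof -
    have "summable (\<lambda>k. z ^ (k + 1) / of_real (P (k + 1)))"
    proof (rule summable_comparison_test')
      show "summable (\<lambda>k. 6 / P 1 * (1 / fact (k + 3)))"
        by (rule summable_mult) (use exp_1_tails(3) in \<open>simp add: sums_iff\<close>)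
      fix k
      have "norm (z ^ (k + 1) / of_real (P (k + 1))) \<le> 1 / P (k + 1)"
        using z Ppos[of "k + 1"] power_le_one[of "norm z" "k + 1"]
        by (simp add: norm_divide norm_power divide_right_mono norm_mult)
      also have "\<dots> \<le> 1 / (fact (k + 3) / 6 * P 1)"
        using growth[of k] Ppos[of 1]
        by (intro divide_left_mono mult_pos_pos) (auto intro: Ppos)
      finally show "norm (z ^ (k + 1) / of_real (P (k + 1))) \<le> 6 / P 1 * (1 / fact (k + 3))"
        by (simp add: mult_ac)
    qed
    then have "summable (\<lambda>m. z ^ m / of_real (P m))"
      by (subst (asm) summable_iff_shift)
    then have "(\<lambda>m. z * of_real (P 0) * (z ^ m / of_real (P m))) sums le_roy_F n \<alpha> \<beta> \<gamma> z"
      unfolding le_roy_F_def P0[symmetric] P_def[symmetric]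
      by (intro sums_mult summable_sums)
    then have "(\<lambda>m. c (Suc m) * z ^ Suc m) sums le_roy_F n \<alpha> \<beta> \<gamma> z"
      by (simp add: c_def mult_ac)
    then show ?thesis using c0 by (subst (asm) sums_Suc_iff) simp
  qed

  define e :: real where "e = exp 1"
  have e: "8 / 3 < e" "e \<le> 3" unfolding e_def using exp_1_gt_8_3 exp_le by auto
  have majorised: "summable (\<lambda>k. w k * norm (c (k + 2))) \<and>
      (\<Sum>k. w k * norm (c (k + 2))) \<le> \<rho> * s"
    if w: "\<And>k. w k \<ge> 0" and s: "(\<lambda>k. w k * (6 / fact (k + 3))) sums s"
    for w :: "nat \<Rightarrow> real" and s
  proof -
    have m: "(\<lambda>k. \<rho> * (w k * (6 / fact (k + 3)))) sums (\<rho> * s)"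
      by (intro sums_mult s)
    have le: "w k * norm (c (k + 2)) \<le> \<rho> * (w k * (6 / fact (k + 3)))" for k
      using mult_left_mono[OF ratio[of k] w[of k]] unfolding nc by (simp only: mult_ac)
    have "summable (\<lambda>k. w k * norm (c (k + 2)))"
      by (rule summable_comparison_test'[OF sums_summable[OF m], of 0])
         (use le w in simp)
    then show ?thesis
      using suminf_le[OF le _ sums_summable[OF m]] sums_unique[OF m] by simp
  qed
  have w0: "exp 1 * real (k + 2) - 1 \<ge> 0" for k
  proof -
    have "1 * 1 \<le> e * real (k + 2)" using e by (intro mult_mono) auto
    then show ?thesis by (simp add: e_def)
  qed
  show ?thesis
  proof (intro conjI impI)
    assume "(2 * exp 1 - 1) * (\<Prod>i=1..n. Gamma (\<beta> i) powr \<gamma> i)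
      < (\<Prod>i=1..n. Gamma (\<alpha> i + \<beta> i) powr \<gamma> i)"
    then have hyp: "(2 * e - 1) * \<rho> < 1"
      unfolding P0[symmetric] P1[symmetric] e_def[symmetric] \<rho>_def
      using Ppos[of 1] by (simp add: field_simps)
    \<comment> \<open>The difference of the two sides below is \<open>2 (e^2 - 7)\<close>.\<close>
    have "e * e \<ge> (8/3) * (8/3)" using e by (intro mult_mono) auto
    then have "15 - 3 * e \<le> (e - 1) * (2 * e - 1)" by (simp add: algebra_simps)
    then have "\<rho> * (15 - 3 * e) \<le> (e - 1) * ((2 * e - 1) * \<rho>)"
      using mult_left_mono[of _ _ \<rho>] \<rho> by (fastforce simp: mult_ac)
    also have "\<dots> < (e - 1) * 1" using hyp e by (intro mult_strict_left_mono) auto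
    finally show "exponentially_starlike (le_roy_F n \<alpha> \<beta> \<gamma>)"
      using majorised[OF w0 starlike_majorant_sums]
      by (intro exponentially_starlike_coeff_criterion[OF ser c0 c1]) (auto simp: e_def)
  next
    assume "(4 * exp 1 ^ 2 - 4 * exp 1 + 2) * (\<Prod>i=1..n. Gamma (\<beta> i) powr \<gamma> i)
      < (exp 1 - 1) * (\<Prod>i=1..n. Gamma (\<alpha> i + \<beta> i) powr \<gamma> i)"
    then have hyp: "(4 * e ^ 2 - 4 * e + 2) * \<rho> < e - 1"
      unfolding P0[symmetric] P1[symmetric] e_def[symmetric] \<rho>_def
      using Ppos[of 1] by (simp add: field_simps)
    \<comment> \<open>The comparison of the coefficients of \<open>\<rho>\<close> amounts to \<open>e (2 e - 5) \<le> 5\<close>.\<close>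
    have "e * (2 * e - 5) \<le> 3 * 1" using e by (intro mult_mono) auto
    then have "6 * e ^ 2 - 9 * e - 3 \<le> 4 * e ^ 2 - 4 * e + 2"
      by (simp add: algebra_simps power2_eq_square)
    then have "\<rho> * (6 * e ^ 2 - 9 * e - 3) \<le> (4 * e ^ 2 - 4 * e + 2) * \<rho>"
      using \<rho> by (subst mult.commute) (intro mult_right_mono, auto)
    also note hyp
    finally have less: "\<rho> * (6 * exp 1 ^ 2 - 9 * exp 1 - 3) < exp 1 - 1" by (simp add: e_def)
    have w0': "real (k + 2) * (exp 1 * real (k + 2) - 1) \<ge> 0" for k
      using w0[of k] by (intro mult_nonneg_nonneg) auto
    show "exponentially_convex (le_roy_F n \<alpha> \<beta> \<gamma>)"
      using majorised[OF w0' convex_majorant_sums] less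
      by (intro exponentially_convex_coeff_criterion[OF ser c0 c1]) auto
  qed
qed

end
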